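(* Let $\mathcal{X}\subset\mathbb{R}^n$ be compact and let $\alpha\in[0,1]$ be a violation level such that $\mathcal{X}_\alpha\neq\emptyset$. Suppose that: (1) $\mathsf{Pr}_\xi\{\xi\in\mathsf{supp}\,p:\bar h(x,\xi)=0\}=0$ for each $x\in\mathcal{X}$; (2) there exists $\mu^*\in A_\alpha$ such that for any $\delta>0$ there exists a probability measure $\mu\in M(\mathcal{X})$, different from $\mu^*$, with $\int_{\mathcal{X}}\mathbb{P}(x)\,d\mu>1-\alpha$ and $\left|\int_{\mathcal{X}}J(x)\,d\mu-\int_{\mathcal{X}}J(x)\,d\mu^*\right|\le\delta$. Then $\mathcal{J}^{\mathsf{w}}_\alpha=\mathcal{J}^*_\alpha$.
   Context: Setting: $J:\mathcal{X}\to\mathbb{R}$ is continuous. $\xi$ is a random variable with values in $\Xi\subseteq\mathbb{R}^s$ having a continuous probability density $p$ with support $\Xi$; $\mathsf{Pr}_\xi$ denotes its law, and $\mathsf{supp}\,p$ is the closure of $\{\xi\in\Xi:p(\xi)>0\}$. $h=(h_1,\dots,h_m):\mathcal{X}\times\Xi\to\mathbb{R}^m$ is continuous, and $\bar h(x,\xi):=\max_{i=1,\dots,m}h_i(x,\xi)$. With $\mathbb{I}\{y\}=1$ if $y\le 0$ and $\mathbb{I}\{y\}=0$ otherwise, $\mathbb{P}(x):=\int_{\Xi}\mathbb{I}\{\bar h(x,\xi)\}p(\xi)\,d\xi$. Put $\mathcal{X}_\alpha:=\{x\in\mathcal{X}:\mathbb{P}(x)\ge 1-\alpha\}$. $M(\mathcal{X})$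 is the set of all Borel probability measures on $\mathcal{X}$, $M_\alpha(\mathcal{X}):=\{\mu\in M(\mathcal{X}):\int_{\mathcal{X}}\mathbb{P}(x)\,d\mu\ge 1-\alpha\}$, $\mathcal{J}^*_\alpha:=\inf_{\mu\in M_\alpha(\mathcal{X})}\int_{\mathcal{X}}J(x)\,d\mu$, and $A_\alpha:=\{\mu\in M_\alpha(\mathcal{X}):\int_{\mathcal{X}}J(x)\,d\mu=\mathcal{J}^*_\alpha\}$. Two-point problem: let $\mathcal{U}_{\mathsf{m}}:=\{\mu_{\mathsf{m}}\in[0,1]^2:\mu_{\mathsf{m}}^{(1)}+\mu_{\mathsf{m}}^{(2)}=1\}$, $\mathcal{Z}_{\mathsf{m}}:=\mathcal{U}_{\mathsf{m}}\times\mathcal{X}^2$ with elements $\boldsymbol{z}_{\mathsf{m}}=(\mu_{\mathsf{m}}^{(1)},\mu_{\mathsf{m}}^{(2)},x^{(1)},x^{(2)})$, and $\mathcal{Z}_{\mathsf{m},\alpha}:=\{\boldsymbol{z}_{\mathsf{m}}\in\mathcal{Z}_{\mathsf{m}}:\sum_{i=1}^2\mathbb{P}(x^{(i)})\mu_{\mathsf{m}}^{(i)}\ge 1-\alpha\}$. Then $\mathcal{J}^{\mathsf{w}}_\alpha:=\min\{\sum_{i=1}^2J(x^{(i)})\mu_{\mathsf{m}}^{(i)}:\boldsymbol{z}_{\mathsf{m}}\in\mathcal{Z}_{\mathsf{m},\alpha}\}$. *)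

theory Defs
  imports "HOL-Probability.Probability"
begin

definition supp :: "'s::topological_space set \<Rightarrow> ('s \<Rightarrow> real) \<Rightarrow> 's set" where
  "supp \<Xi> p = closure {y \<in> \<Xi>. p y > 0}"

text \<open>The index type \<open>'m\<close> is finite and nonempty, so the maximum below exists.\<close>

definition hbar :: "('x \<Rightarrow> 's \<Rightarrow> real ^ 'm::finite) \<Rightarrow> 'x \<Rightarrow> 's \<Rightarrow> real" where
  "hbar h x y = Max (range (\<lambda>i. h x y $ i))"

definition nonpos_ind :: "real \<Rightarrow> real" where
  "nonpos_ind t = (if t \<le> 0 then 1 else 0)"

definition sat_prob ::
  "'s::euclidean_space set \<Rightarrow> ('s \<Rightarrow> real) \<Rightarrow> ('x \<Rightarrow> 's \<Rightarrow> real ^ 'm::finite) \<Rightarrow> 'x \<Rightarrow> real" where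
  "sat_prob \<Xi> p h x = (LINT y:\<Xi>|lborel. nonpos_ind (hbar h x y) * p y)"

text \<open>In what follows \<open>P\<close> stands for the satisfaction probability \<open>sat_prob \<Xi> p h\<close>.\<close>

definition X_alpha :: "'x set \<Rightarrow> ('x \<Rightarrow> real) \<Rightarrow> real \<Rightarrow> 'x set" where
  "X_alpha X P \<alpha> = {x \<in> X. P x \<ge> 1 - \<alpha>}"

definition prob_measures_on :: "'x::topological_space set \<Rightarrow> 'x measure set" where
  "prob_measures_on X = {\<mu>. prob_space \<mu> \<and> sets \<mu> = sets (restrict_space borel X)}"

definition M_alpha :: "'x::topological_space set \<Rightarrow> ('x \<Rightarrow> real) \<Rightarrow> real \<Rightarrow> 'x measure set" where
  "M_alpha X P \<alpha> = {\<mu> \<in> prob_measures_on X. (LINT x|\<mu>. P x) \<ge> 1 - \<alpha>}"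

definition J_star ::
  "'x::topological_space set \<Rightarrow> ('x \<Rightarrow> real) \<Rightarrow> ('x \<Rightarrow> real) \<Rightarrow> real \<Rightarrow> real" where
  "J_star X J P \<alpha> = (INF \<mu> \<in> M_alpha X P \<alpha>. LINT x|\<mu>. J x)"

definition A_alpha ::
  "'x::topological_space set \<Rightarrow> ('x \<Rightarrow> real) \<Rightarrow> ('x \<Rightarrow> real) \<Rightarrow> real \<Rightarrow> 'x measure set" where
  "A_alpha X J P \<alpha> = {\<mu> \<in> M_alpha X P \<alpha>. (LINT x|\<mu>. J x) = J_star X J P \<alpha>}"

definition U_m :: "(real ^ 2) set" where
  "U_m = {u. (\<forall>i. u $ i \<in> {0..1}) \<and> u $ 1 + u $ 2 = 1}"

definition Z_m :: "'x set \<Rightarrow> ((real ^ 2) \<times> ('x ^ 2)) set" where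
  "Z_m X = U_m \<times> {x. \<forall>i. x $ i \<in> X}"

definition Z_m_alpha :: "'x set \<Rightarrow> ('x \<Rightarrow> real) \<Rightarrow> real \<Rightarrow> ((real ^ 2) \<times> ('x ^ 2)) set" where
  "Z_m_alpha X P \<alpha> = {(u, x) \<in> Z_m X. (\<Sum>i\<in>UNIV. P (x $ i) * u $ i) \<ge> 1 - \<alpha>}"

text \<open>\<open>LEAST\<close> renders a minimum: it is an unspecified value, not the infimum, if the
  minimum is not attained.\<close>

definition J_w :: "'x set \<Rightarrow> ('x \<Rightarrow> real) \<Rightarrow> ('x \<Rightarrow> real) \<Rightarrow> real \<Rightarrow> real" where
  "J_w X J P \<alpha> = (LEAST v. v \<in> (\<lambda>(u, x). \<Sum>i\<in>UNIV. J (x $ i) * u $ i) ` Z_m_alpha X P \<alpha>)"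

end

theory Submission
  imports Defs
begin

text \<open>Write \<open>P\<close> for the satisfaction probability and let \<open>K = {(P x, J x) | x \<in> X}\<close>, a subset of the
  plane. A measure \<open>\<mu>\<close> on \<open>X\<close> enters its own optimisation problem only through the point
  \<open>(\<integral>P d\<mu>, \<integral>J d\<mu>)\<close>, and a two-point weighting of \<open>X\<close> only through a convex combination of two
  points of \<open>K\<close>. So both problems minimise the second coordinate, subject to the first being at
  least \<open>1 - \<alpha>\<close>, over planar sets that lie in the convex hull of \<open>K\<close>.

  The two problems have the same value because the minimum over the hull is attained at a point
  that is reached by two points of \<open>K\<close>. The minimum exists because \<open>K\<close> is compact, which needs \<open>P\<close> to
  be continuous: when \<open>x\<close> varies, the indicator jumps only at parameters with \<open>hbar = 0\<close>, which
  carry no mass, and dominated convergence applies (\<open>continuous_on_sat_prob\<close>). The minimiser lies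
  on the boundary of the hull, since moving down from it leaves the hull; a supporting line there
  cuts out a face of dimension at most one, in which Caratheodory's theorem asks for only two
  points (\<open>caratheodory_boundary\<close>, \<open>two_point_minimizer\<close>).

  Conversely, no measure does better, since the mean of a vector-valued map lies in every closed
  convex set that contains its values (\<open>expectation_in_closed_convex\<close>); and the two optimal points
  define a measure with two atoms, so the infimum over measures is this minimum as well.\<close>

section \<open>Continuity of the satisfaction probability\<close>

lemma continuous_on_Max:
  fixes f :: "'i \<Rightarrow> 'a::topological_space \<Rightarrow> real"
  assumes "finite I" "I \<noteq> {}" "\<And>i. i \<in> I \<Longrightarrow> continuous_on S (f i)"
  shows "continuous_on S (\<lambda>x. Max ((\<lambda>i. f i x) ` I))"
  using assms
proof (induction rule: finite_ne_induct)
  case (singleton i)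
  then show ?case by simp
next
  case (insert i I)
  then have "continuous_on S (\<lambda>x. max (f i x) (Max ((\<lambda>i. f i x) ` I)))"
    by (intro continuous_on_max) auto
  with insert.hyps show ?case by simp
qed

lemma continuous_on_hbar:
  assumes "continuous_on (X \<times> Y) (\<lambda>(x, y). h x y)"
  shows "continuous_on (X \<times> Y) (\<lambda>(x, y). hbar h x y)"
proof -
  have "continuous_on (X \<times> Y) (\<lambda>z. Max (range (\<lambda>i. (\<lambda>(x, y). h x y) z $ i)))"
    by (intro continuous_on_Max continuous_on_component assms) auto
  then show ?thesis
    by (simp add: hbar_def case_prod_beta)
qed

lemma continuous_on_hbar_section:
  assumes "continuous_on (X \<times> Y) (\<lambda>(x, y). h x y)" "x \<in> X"
  shows "continuous_on Y (hbar h x)"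
proof -
  have "continuous_on Y (\<lambda>y. (x, y))"
    by (rule continuous_on_Pair[OF continuous_on_const continuous_on_id])
  from continuous_on_compose2[OF continuous_on_hbar[OF assms(1)] this] assms(2)
  show ?thesis by auto
qed

text \<open>Away from \<open>0\<close> the indicator is locally constant.\<close>
lemma nonpos_ind_tendsto:
  fixes f :: "nat \<Rightarrow> real"
  assumes "f \<longlonglongrightarrow> l" "l \<noteq> 0"
  shows "(\<lambda>n. nonpos_ind (f n)) \<longlonglongrightarrow> nonpos_ind l"
proof (rule tendsto_eventually)
  show "\<forall>\<^sub>F n in sequentially. nonpos_ind (f n) = nonpos_ind l"
  proof (cases "l < 0")
    case True
    then have "\<forall>\<^sub>F n in sequentially. f n < 0" using assms(1) by (rule order_tendstoD(2)[rotated])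
    then show ?thesis by eventually_elim (use True in \<open>simp add: nonpos_ind_def\<close>)
  next
    case False
    with assms(2) have "0 < l" by simp
    then have "\<forall>\<^sub>F n in sequentially. 0 < f n" using assms(1) by (rule order_tendstoD(1)[rotated])
    then show ?thesis by eventually_elim (use \<open>0 < l\<close> in \<open>simp add: nonpos_ind_def\<close>)
  qed
qed

text \<open>The hypothesis \<open>null\<close> says that for each \<open>x\<close> the density vanishes almost everywhere on the
  level set \<open>hbar h x = 0\<close>, the only place where the integrand can be discontinuous in \<open>x\<close>. The
  density itself dominates all integrands.\<close>
lemma continuous_on_sat_prob:
  fixes h :: "'x::metric_space \<Rightarrow> 's::euclidean_space \<Rightarrow> real ^ 'm"
  assumes \<Xi>: "closed \<Xi>"
    and h: "continuous_on (X \<times> \<Xi>) (\<lambda>(x, y). h x y)"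
    and p: "set_integrable lborel \<Xi> p"
    and null: "\<And>x. x \<in> X \<Longrightarrow> AE y in lborel. y \<in> \<Xi> \<longrightarrow> hbar h x y = 0 \<longrightarrow> p y = 0"
  shows "continuous_on X (sat_prob \<Xi> p h)"
  unfolding continuous_on_sequentially comp_def
proof (intro allI impI ballI, elim conjE)
  fix u x assume x: "x \<in> X" and u: "\<forall>n. u n \<in> X" and lim: "u \<longlonglongrightarrow> x"
  have cont: "continuous_on (X \<times> \<Xi>) (\<lambda>(x, y). hbar h x y)"
    by (rule continuous_on_hbar[OF h])
  let ?g = "\<lambda>x y. indicator \<Xi> y *\<^sub>R (nonpos_ind (hbar h x y) * p y)"
  have ip: "integrable lborel (\<lambda>y. indicator \<Xi> y *\<^sub>R p y)"
    using p by (simp add: set_integrable_def)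
  have meas: "?g x \<in> borel_measurable lborel" if x: "x \<in> X" for x
  proof -
    have "continuous_on \<Xi> (hbar h x)"
      by (rule continuous_on_hbar_section[OF h x])
    then have "closed (\<Xi> \<inter> hbar h x -` {..0})"
      by (rule continuous_closed_preimage[OF _ \<Xi>]) simp
    also have "\<Xi> \<inter> hbar h x -` {..0} = {y \<in> \<Xi>. hbar h x y \<le> 0}" by blast
    finally have "{y \<in> \<Xi>. hbar h x y \<le> 0} \<in> sets lborel"
      unfolding sets_lborel by (rule borel_closed)
    then have "(\<lambda>y. indicator {y \<in> \<Xi>. hbar h x y \<le> 0} y *\<^sub>R (indicator \<Xi> y *\<^sub>R p y)) \<in> borel_measurable lborel"
      by (intro borel_measurable_scaleR borel_measurable_indicator borel_measurable_integrable[OF ip])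
    \<comment> \<open>The product \<open>indicator \<Xi> * p\<close> is known to be measurable only as a whole, so the constraint
      enters as a further indicator factor.\<close>
    also have "(\<lambda>y. indicator {y \<in> \<Xi>. hbar h x y \<le> 0} y *\<^sub>R (indicator \<Xi> y *\<^sub>R p y)) = ?g x"
      by (auto simp: fun_eq_iff nonpos_ind_def indicator_def)
    finally show ?thesis .
  qed
  have "(\<lambda>n. integral\<^sup>L lborel (?g (u n))) \<longlonglongrightarrow> integral\<^sup>L lborel (?g x)"
  proof (rule integral_dominated_convergence)
    show "integrable lborel (\<lambda>y. \<bar>indicator \<Xi> y *\<^sub>R p y\<bar>)" using ip by (rule integrable_abs)
    show "?g x \<in> borel_measurable lborel" by (rule meas[OF x])
    show "?g (u n) \<in> borel_measurable lborel" for n using meas u by blast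
    show "AE y in lborel. norm (?g (u n) y) \<le> \<bar>indicator \<Xi> y *\<^sub>R p y\<bar>" for n
      by (simp add: nonpos_ind_def indicator_def)
    show "AE y in lborel. (\<lambda>n. ?g (u n) y) \<longlonglongrightarrow> ?g x y"
      using null[OF x]
    proof eventually_elim
      case (elim y)
      show ?case
      proof (cases "y \<in> \<Xi> \<and> hbar h x y \<noteq> 0")
        case True
        have "(\<lambda>n. (u n, y)) \<longlonglongrightarrow> (x, y)" by (intro tendsto_intros lim)
        then have "(\<lambda>n. hbar h (u n) y) \<longlonglongrightarrow> hbar h x y"
          using continuous_on_tendsto_compose[OF cont, of "\<lambda>n. (u n, y)" "(x, y)" sequentially] True u x
          by simp
        then have "(\<lambda>n. nonpos_ind (hbar h (u n) y)) \<longlonglongrightarrow> nonpos_ind (hbar h x y)"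
          using True by (intro nonpos_ind_tendsto) auto
        then show ?thesis by (intro tendsto_intros)
      next
        case False
        with elim show ?thesis by (auto simp: indicator_def)
      qed
    qed
  qed
  then show "(\<lambda>n. sat_prob \<Xi> p h (u n)) \<longlonglongrightarrow> sat_prob \<Xi> p h x"
    by (simp add: sat_prob_def set_lebesgue_integral_def)
qed

text \<open>Conditions on the law of \<open>\<xi>\<close> become conditions on its density: a null set of the law is one on
  which the density vanishes Lebesgue-almost everywhere.\<close>
lemma distributed_AE_density_zero:
  fixes \<xi> :: "'w \<Rightarrow> 's::euclidean_space" and p :: "'s \<Rightarrow> real"
  assumes "prob_space \<Omega>" and D: "distributed \<Omega> lborel \<xi> (\<lambda>y. ennreal (p y) * indicator \<Xi> y)"
    and pos: "\<forall>y\<in>\<Xi>. p y \<ge> 0"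
    and N: "N \<in> sets borel" and 0: "measure (distr \<Omega> borel \<xi>) N = 0"
  shows "AE y in lborel. y \<in> \<Xi> \<longrightarrow> y \<in> N \<longrightarrow> p y = 0"
proof -
  let ?f = "\<lambda>y. ennreal (p y) * indicator \<Xi> y"
  interpret prob_space \<Omega> by fact
  have m: "\<xi> \<in> measurable \<Omega> borel" using distributed_measurable[OF D] by simp
  interpret d: prob_space "distr \<Omega> borel \<xi>" by (rule prob_space_distr[OF m])
  have eq: "distr \<Omega> borel \<xi> = density lborel ?f"
    using distributed_distr_eq_density[OF D] distr_cong[of \<Omega> \<Omega> borel lborel \<xi> \<xi>] by simp
  have f: "?f \<in> borel_measurable lborel" by (rule distributed_borel_measurable[OF D])
  have "emeasure (density lborel ?f) N = 0"
    using 0 d.emeasure_eq_measure[of N] by (simp add: eq)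
  then have "(\<integral>\<^sup>+ y. ?f y * indicator N y \<partial>lborel) = 0"
    using f N by (simp add: emeasure_density)
  then have "AE y in lborel. ?f y * indicator N y = 0"
    using f N by (subst (asm) nn_integral_0_iff_AE) auto
  then show ?thesis
    by eventually_elim (use pos in \<open>auto simp: indicator_def ennreal_eq_0_iff split: if_splits intro: antisym\<close>)
qed

lemma distributed_set_integrable:
  fixes \<xi> :: "'w \<Rightarrow> 's::euclidean_space" and p :: "'s \<Rightarrow> real"
  assumes "prob_space \<Omega>" and D: "distributed \<Omega> lborel \<xi> (\<lambda>y. ennreal (p y) * indicator \<Xi> y)"
    and pos: "\<forall>y\<in>\<Xi>. p y \<ge> 0"
    and meas: "set_borel_measurable lborel \<Xi> p"
  shows "set_integrable lborel \<Xi> p"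
  unfolding set_integrable_def
proof (rule integrableI_bounded)
  let ?f = "\<lambda>y. ennreal (p y) * indicator \<Xi> y"
  interpret prob_space \<Omega> by fact
  interpret d: prob_space "density lborel ?f"
    using prob_space_distr[OF distributed_measurable[OF D]]
    by (simp add: distributed_distr_eq_density[OF D])
  show "(\<lambda>y. indicator \<Xi> y *\<^sub>R p y) \<in> borel_measurable lborel"
    using meas by (simp add: set_borel_measurable_def)
  have "(\<integral>\<^sup>+ y. ennreal (norm (indicator \<Xi> y *\<^sub>R p y)) \<partial>lborel) = (\<integral>\<^sup>+ y. ?f y \<partial>lborel)"
    using pos by (intro nn_integral_cong) (auto simp: indicator_def)
  also have "\<dots> = 1"
    using d.emeasure_space_1 distributed_borel_measurable[OF D] by (simp add: emeasure_density)
  finally show "(\<integral>\<^sup>+ y. ennreal (norm (indicator \<Xi> y *\<^sub>R p y)) \<partial>lborel) < \<infinity>" by simp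
qed

section \<open>Convex hulls, means and boundary points\<close>

text \<open>If the mean were outside \<open>H\<close>, a hyperplane would separate it strictly from \<open>H\<close>; but the
  linear functional of that hyperplane commutes with the integral, and its values on \<open>H\<close> are all
  on the other side.\<close>
lemma expectation_in_closed_convex:
  fixes f :: "'a \<Rightarrow> 'b::euclidean_space"
  assumes "prob_space \<mu>" and f: "integrable \<mu> f"
    and H: "convex H" "closed H" "\<And>x. x \<in> space \<mu> \<Longrightarrow> f x \<in> H"
  shows "integral\<^sup>L \<mu> f \<in> H"
proof (rule ccontr)
  interpret prob_space \<mu> by fact
  assume "integral\<^sup>L \<mu> f \<notin> H"
  then obtain a b where ab: "a \<bullet> integral\<^sup>L \<mu> f < b" "\<forall>x\<in>H. b < a \<bullet> x"
    using separating_hyperplane_closed_point[OF H(1,2)] by blast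
  have "b \<le> (LINT x|\<mu>. a \<bullet> f x)"
    using ab(2) H(3) f by (intro integral_ge_const AE_I2) (auto intro: less_imp_le)
  with ab(1) f show False by simp
qed

text \<open>Caratheodory's theorem needs \<open>DIM('a) + 1\<close> points in general. At a boundary point one can be saved:
  the face cut out by a supporting hyperplane is itself the hull of points of \<open>K\<close>, and lies in a
  space of one dimension less.\<close>
lemma caratheodory_boundary:
  fixes K :: "'a::euclidean_space set"
  assumes K: "compact K" and z: "z \<in> convex hull K" "z \<notin> interior (convex hull K)"
  obtains S where "finite S" "S \<subseteq> K" "card S \<le> DIM('a)" "z \<in> convex hull S"
proof -
  have "\<exists>F\<subseteq>K. z \<in> convex hull F \<and> aff_dim F < DIM('a)"
    \<comment> \<open>The interior is the relative interior only in full dimension; otherwise \<open>K\<close> itself is a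
      suitable \<open>F\<close>.\<close>
  proof (cases "aff_dim K = DIM('a)")
    case True
    then have "z \<notin> rel_interior (convex hull K)"
      using z(2) interior_rel_interior_gen[of "convex hull K"] by (simp add: aff_dim_convex_hull)
    then obtain a where a: "a \<noteq> 0" "\<And>y. y \<in> convex hull K \<Longrightarrow> a \<bullet> z \<le> a \<bullet> y"
      by (rule supporting_hyperplane_rel_boundary[OF convex_convex_hull z(1)]) (rule that)
    have "(convex hull K \<inter> {y. a \<bullet> y = a \<bullet> z}) face_of (convex hull K)"
      using a(2) by (intro face_of_Int_supporting_hyperplane_ge) auto
    then obtain F where F: "F \<subseteq> K" "convex hull K \<inter> {y. a \<bullet> y = a \<bullet> z} = convex hull F"
      using face_of_convex_hull_subset[OF K] by blast
    have "F \<subseteq> {y. a \<bullet> y = a \<bullet> z}" using F(2) hull_subset[of F convex] by blast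
    then have "aff_dim F \<le> aff_dim {y. a \<bullet> y = a \<bullet> z}" by (rule aff_dim_subset)
    with a(1) have "aff_dim F < DIM('a)" by simp
    moreover have "z \<in> convex hull F" using F(2) z(1) by blast
    ultimately show ?thesis using F(1) by blast
  next
    case False
    with aff_dim_le_DIM[of K] z(1) show ?thesis by auto
  qed
  then obtain F where F: "F \<subseteq> K" "z \<in> convex hull F" "aff_dim F < DIM('a)" by blast
  from F(2) obtain S where "finite S" "S \<subseteq> F" "card S \<le> aff_dim F + 1" "z \<in> convex hull S"
    unfolding caratheodory_aff_dim[of F] by blast
  with F(1,3) show thesis by (intro that[of S]) auto
qed

lemma convex_hull_card_le_2:
  fixes z :: "'a::real_vector"
  assumes "finite S" "card S \<le> 2" "z \<in> convex hull S"
  obtains a b where "a \<in> S" "b \<in> S" "z \<in> closed_segment a b"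
proof -
  have "card S = 0 \<or> card S = 1 \<or> card S = 2" using assms(2) by linarith
  then consider "S = {}" | a where "S = {a}" | a b where "S = {a, b}"
    using assms(1) by (auto simp: card_1_singleton_iff card_2_iff)
  then show thesis
  proof cases
    case 1
    with assms(3) show thesis by simp
  next
    case (2 a)
    with assms(3) that[of a a] show thesis by simp
  next
    case (3 a b)
    with assms(3) that[of a b] show thesis by (simp add: segment_convex_hull)
  qed
qed

text \<open>The linear programme over the hull of a planar set: the bound \<open>c\<close> on the first coordinate costs
  a second point, and nothing more, because a minimiser of the second coordinate cannot be
  interior to the hull.\<close>
lemma two_point_minimizer:
  fixes K :: "(real \<times> real) set"
  assumes K: "compact K" and ne: "\<exists>z\<in>convex hull K. c \<le> fst z"
  obtains a b z where "a \<in> K" "b \<in> K" "z \<in> closed_segment a b" "c \<le> fst z"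
    "\<And>y. y \<in> convex hull K \<Longrightarrow> c \<le> fst y \<Longrightarrow> snd z \<le> snd y"
proof -
  let ?H = "convex hull K" and ?C = "convex hull K \<inter> {y. c \<le> fst y}"
  have "compact ?C"
    by (intro compact_Int_closed compact_convex_hull K closed_Collect_le continuous_intros)
  moreover have "?C \<noteq> {}" using ne by blast
  ultimately obtain z where z: "z \<in> ?C" "\<And>y. y \<in> ?C \<Longrightarrow> snd z \<le> snd y"
    using continuous_attains_inf[of ?C snd] continuous_on_snd[OF continuous_on_id] by blast
  have "z \<notin> interior ?H"
  proof
    assume "z \<in> interior ?H"
    then obtain e where e: "e > 0" "cball z e \<subseteq> ?H" by (auto simp: mem_interior_cball)
    \<comment> \<open>Lowering only the second coordinate keeps the constraint and beats the minimum.\<close>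
    have "z - (0, e) \<in> cball z e" using e(1) by (simp add: dist_norm norm_Pair)
    with e(2) z(1) have "z - (0, e) \<in> ?C" by auto
    from z(2)[OF this] e(1) show False by simp
  qed
  moreover have "z \<in> ?H" using z(1) by blast
  ultimately obtain S where S: "finite S" "S \<subseteq> K" "card S \<le> DIM(real \<times> real)" "z \<in> convex hull S"
    using caratheodory_boundary[OF K] by metis
  from S(3) have "card S \<le> 2" by simp
  with S(1,4) obtain a b where "a \<in> S" "b \<in> S" "z \<in> closed_segment a b"
    using convex_hull_card_le_2 by metis
  with S(2) z show thesis by (intro that[of a b z]) auto
qed

section \<open>Measures on a compact set\<close>

lemma integrable_continuous_on_compact:
  fixes f :: "'a::topological_space \<Rightarrow> real"
  assumes X: "compact X" and f: "continuous_on X f" and \<mu>: "\<mu> \<in> prob_measures_on X"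
  shows "integrable \<mu> f"
proof -
  interpret prob_space \<mu> using \<mu> by (simp add: prob_measures_on_def)
  have sets: "sets \<mu> = sets (restrict_space borel X)" using \<mu> by (simp add: prob_measures_on_def)
  then have sp: "space \<mu> = X" by (simp add: sets_eq_imp_space_eq[OF sets] space_restrict_space)
  have "f \<in> borel_measurable \<mu>"
    using borel_measurable_continuous_on_restrict[OF f] by (simp cong: measurable_cong_sets add: sets)
  moreover obtain B where "\<And>x. x \<in> X \<Longrightarrow> norm (f x) \<le> B"
    using compact_imp_bounded[OF compact_continuous_image[OF f X]] by (auto simp: bounded_iff)
  ultimately show ?thesis using sp by (intro integrable_const_bound[where B=B]) auto
qed

text \<open>The measure is the image of a Bernoulli variable that selects \<open>a\<close> with probability \<open>t\<close>. This
  also covers \<open>a = b\<close>, where the two atoms merge.\<close>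
lemma two_point_measure:
  fixes X :: "'a::t1_space set"
  assumes X: "a \<in> X" "b \<in> X" and t: "0 \<le> t" "t \<le> 1"
  obtains \<mu> where "\<mu> \<in> prob_measures_on X"
    "\<And>f :: 'a \<Rightarrow> real. continuous_on X f \<Longrightarrow> (LINT x|\<mu>. f x) = t * f a + (1 - t) * f b"
proof
  let ?g = "\<lambda>i. if i then a else b"
  let ?\<mu> = "distr (bernoulli_pmf t) (restrict_space borel X) ?g"
  have g: "?g \<in> measurable (bernoulli_pmf t) (restrict_space borel X)"
    using X by (auto simp: space_restrict_space)
  show "?\<mu> \<in> prob_measures_on X"
    using measure_pmf.prob_space_distr[OF g] by (simp add: prob_measures_on_def)
  fix f :: "'a \<Rightarrow> real" assume "continuous_on X f"
  then show "(LINT x|?\<mu>. f x) = t * f a + (1 - t) * f b"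
    using t by (subst integral_distr[OF g borel_measurable_continuous_on_restrict]) (auto simp: mult.commute)
qed

section \<open>Two atoms suffice\<close>

text \<open>Both values equal the least second coordinate \<open>snd z\<close> over the part of the hull of \<open>K\<close> with first
  coordinate at least \<open>1 - \<alpha>\<close>. For each problem this is a lower bound, since its candidates map into
  that part of the hull, and it is attained, since \<open>z\<close> lies on a segment between two points of \<open>K\<close>.\<close>
lemma J_w_eq_J_star:
  fixes X :: "'a::t1_space set"
  assumes X: "compact X" and J: "continuous_on X J" and P: "continuous_on X P"
    and ne: "X_alpha X P \<alpha> \<noteq> {}"
  shows "J_w X J P \<alpha> = J_star X J P \<alpha>"
proof -
  let ?F = "\<lambda>x. (P x, J x)"
  define K where "K = ?F ` X"
  have K: "compact K" unfolding K_def by (intro compact_continuous_image continuous_on_Pair P J X)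
  obtain x0 where "x0 \<in> X" "1 - \<alpha> \<le> P x0" using ne by (auto simp: X_alpha_def)
  then have "?F x0 \<in> convex hull K" "1 - \<alpha> \<le> fst (?F x0)"
    by (auto simp: K_def intro: hull_inc)
  then obtain k1 k2 z where k: "k1 \<in> K" "k2 \<in> K" and z: "z \<in> closed_segment k1 k2" "1 - \<alpha> \<le> fst z"
    and min: "\<And>y. y \<in> convex hull K \<Longrightarrow> 1 - \<alpha> \<le> fst y \<Longrightarrow> snd z \<le> snd y"
    using two_point_minimizer[OF K, of "1 - \<alpha>"] by metis
  obtain a b where ab: "a \<in> X" "b \<in> X" "k1 = ?F a" "k2 = ?F b" using k by (auto simp: K_def)
  obtain t where t: "0 \<le> t" "t \<le> 1" and zt: "z = (1 - t) *\<^sub>R k1 + t *\<^sub>R k2"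
    using z(1) by (auto simp: in_segment)
  have zP: "fst z = t * P b + (1 - t) * P a" and zJ: "snd z = t * J b + (1 - t) * J a"
    by (simp_all add: zt ab)

  have "J_w X J P \<alpha> = snd z"
    unfolding J_w_def
  proof (rule Least_equality)
    have "(vector [1 - t, t], (\<chi> i. if i = 1 then a else b)) \<in> Z_m_alpha X P \<alpha>"
      using t ab(1,2) z(2) zP
      by (simp add: Z_m_alpha_def Z_m_def U_m_def forall_2 sum_2 vector_2 algebra_simps)
    then show "snd z \<in> (\<lambda>(u, x). \<Sum>i\<in>UNIV. J (x $ i) * u $ i) ` Z_m_alpha X P \<alpha>"
      by (rule rev_image_eqI) (simp add: sum_2 vector_2 zJ)
  next
    fix v assume "v \<in> (\<lambda>(u, x). \<Sum>i\<in>UNIV. J (x $ i) * u $ i) ` Z_m_alpha X P \<alpha>"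
    then obtain u :: "real ^ 2" and x :: "'a ^ 2" where ux: "(u, x) \<in> Z_m_alpha X P \<alpha>"
      and v: "v = J (x $ 1) * u $ 1 + J (x $ 2) * u $ 2"
      by (auto simp: sum_2)
    let ?y = "u $ 1 *\<^sub>R ?F (x $ 1) + u $ 2 *\<^sub>R ?F (x $ 2)"
    have "?F (x $ 1) \<in> convex hull K" "?F (x $ 2) \<in> convex hull K"
      using ux by (auto simp: K_def Z_m_alpha_def Z_m_def intro!: hull_inc)
    then have "?y \<in> convex hull K"
      using ux by (intro convexD[OF convex_convex_hull]) (auto simp: Z_m_alpha_def Z_m_def U_m_def)
    moreover have "1 - \<alpha> \<le> fst ?y"
      using ux by (simp add: Z_m_alpha_def sum_2 mult.commute)
    ultimately have "snd z \<le> snd ?y" by (rule min)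
    then show "snd z \<le> v" by (simp add: v mult.commute)
  qed

  moreover have "J_star X J P \<alpha> = snd z"
    unfolding J_star_def
  proof (rule cInf_eq_minimum)
    obtain \<mu> where \<mu>: "\<mu> \<in> prob_measures_on X"
      and int: "\<And>f :: 'a \<Rightarrow> real. continuous_on X f \<Longrightarrow> (LINT x|\<mu>. f x) = t * f b + (1 - t) * f a"
      using two_point_measure[OF ab(2,1) t] by blast
    have "\<mu> \<in> M_alpha X P \<alpha>" using \<mu> z(2) by (simp add: M_alpha_def int[OF P] zP)
    then show "snd z \<in> (\<lambda>\<mu>. LINT x|\<mu>. J x) ` M_alpha X P \<alpha>"
      by (rule rev_image_eqI) (simp add: int[OF J] zJ)
  next
    fix v assume "v \<in> (\<lambda>\<mu>. LINT x|\<mu>. J x) ` M_alpha X P \<alpha>"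
    then obtain \<mu> where v: "v = (LINT x|\<mu>. J x)" and \<mu>: "\<mu> \<in> prob_measures_on X"
      and ge: "1 - \<alpha> \<le> (LINT x|\<mu>. P x)" by (auto simp: M_alpha_def)
    have "prob_space \<mu>" using \<mu> by (simp add: prob_measures_on_def)
    have "space \<mu> = X"
      using \<mu> sets_eq_imp_space_eq[of \<mu> "restrict_space borel X"]
      by (simp add: prob_measures_on_def space_restrict_space)
    have iP: "integrable \<mu> P" and iJ: "integrable \<mu> J"
      using integrable_continuous_on_compact[OF X _ \<mu>] P J by auto
    have iF: "integrable \<mu> ?F"
    proof -
      \<comment> \<open>Writing the pair in the standard basis reduces its integrability to that of \<open>P\<close> and \<open>J\<close>.\<close>
      have "integrable \<mu> (\<lambda>x. P x *\<^sub>R (1, 0) + J x *\<^sub>R (0, 1 :: real) :: real \<times> real)"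
        using iP iJ by (intro Bochner_Integration.integrable_add integrable_scaleR_left) auto
      then show ?thesis by simp
    qed
    have "integral\<^sup>L \<mu> ?F \<in> convex hull K"
      using \<open>space \<mu> = X\<close> K
      by (intro expectation_in_closed_convex[OF \<open>prob_space \<mu>\<close> iF])
        (auto simp: K_def intro: hull_inc compact_imp_closed compact_convex_hull)
    moreover have "fst (integral\<^sup>L \<mu> ?F) = (LINT x|\<mu>. P x)" "snd (integral\<^sup>L \<mu> ?F) = (LINT x|\<mu>. J x)"
      using integral_fst[OF iF] integral_snd[OF iF] by simp_all
    ultimately show "snd z \<le> v" using min ge v by metis
  qed
  ultimately show ?thesis by simp
qed

text \<open>By \<open>supp \<Xi> p = \<Xi>\<close> the set \<open>\<Xi>\<close> is closed, so the zero sets of \<open>hbar h x\<close> are Borel sets and the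
  assumption on their probability passes to the density; this makes the satisfaction probability
  continuous, and the two-atom argument applies.\<close>
theorem theorem2:
  fixes X :: "(real ^ 'n) set"
    and \<Xi> :: "(real ^ 's) set"
    and J :: "real ^ 'n \<Rightarrow> real"
    and h :: "real ^ 'n \<Rightarrow> real ^ 's \<Rightarrow> real ^ 'm"
    and p :: "real ^ 's \<Rightarrow> real"
    and \<Omega> :: "'w measure"
    and \<xi> :: "'w \<Rightarrow> real ^ 's"
    and \<alpha> :: real
  assumes "compact X"
    and "continuous_on X J"
    and "continuous_on (X \<times> \<Xi>) (\<lambda>(x, y). h x y)"
    and "continuous_on \<Xi> p"
    and "\<forall>y\<in>\<Xi>. p y \<ge> 0"
    and "supp \<Xi> p = \<Xi>"
    and "prob_space \<Omega>"
    and "\<xi> \<in> space \<Omega> \<rightarrow> \<Xi>"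
    and "distributed \<Omega> lborel \<xi> (\<lambda>y. ennreal (p y) * indicator \<Xi> y)"
    and "\<alpha> \<in> {0..1}"
    and "X_alpha X (sat_prob \<Xi> p h) \<alpha> \<noteq> {}"
    and "\<forall>x\<in>X. measure (distr \<Omega> borel \<xi>) {y \<in> supp \<Xi> p. hbar h x y = 0} = 0"
    and "\<exists>\<mu>s \<in> A_alpha X J (sat_prob \<Xi> p h) \<alpha>. \<forall>\<delta>>0. \<exists>\<mu> \<in> prob_measures_on X.
           \<mu> \<noteq> \<mu>s \<and> (LINT x|\<mu>. sat_prob \<Xi> p h x) > 1 - \<alpha> \<and>
           \<bar>(LINT x|\<mu>. J x) - (LINT x|\<mu>s. J x)\<bar> \<le> \<delta>"
  shows "J_w X J (sat_prob \<Xi> p h) \<alpha> = J_star X J (sat_prob \<Xi> p h) \<alpha>"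
proof (rule J_w_eq_J_star)
  have cl: "closed \<Xi>" using assms(6) by (metis supp_def closed_closure)
  show "continuous_on X (sat_prob \<Xi> p h)"
  proof (rule continuous_on_sat_prob[OF cl assms(3)])
    have "set_borel_measurable lborel \<Xi> p"
      unfolding set_borel_measurable_def
      using borel_measurable_continuous_on_indicator[OF _ assms(4)] cl by simp
    then show "set_integrable lborel \<Xi> p"
      by (rule distributed_set_integrable[OF assms(7,9,5)])
    fix x assume x: "x \<in> X"
    let ?N = "{y \<in> \<Xi>. hbar h x y = 0}"
    have "continuous_on \<Xi> (hbar h x)"
      by (rule continuous_on_hbar_section[OF assms(3) x])
    then have "closed ?N" by (rule continuous_closed_preimage_constant[OF _ cl])
    moreover have "measure (distr \<Omega> borel \<xi>) ?N = 0"
      using assms(6,12) x by simp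
    ultimately have "AE y in lborel. y \<in> \<Xi> \<longrightarrow> y \<in> ?N \<longrightarrow> p y = 0"
      by (intro distributed_AE_density_zero[OF assms(7,9,5)]) simp
    then show "AE y in lborel. y \<in> \<Xi> \<longrightarrow> hbar h x y = 0 \<longrightarrow> p y = 0"
      by eventually_elim auto
  qed
qed (use assms in auto)

end
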